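(* Let $X=\mathcal V(g_1,\ldots,g_s)\cap\Delta_n$ be an algebraic statistical model, with Lagrange likelihood correspondence $\mathcal L_X\subset\mathbb C^{n+1}\times\mathbb C^{n+1}\times\mathbb C^{s+1}$, let $J$ be the Jacobian determinant of the Lagrange likelihood equations with respect to the unknowns $(\mathbf p,\Lambda)$, let $\pi$ be the projection onto the $\mathbf u$-coordinates, and let $\mathcal L_{X,J}=\overline{\pi(\mathcal L_X\cap\mathcal V_a(J))}\subset\mathbb C^{n+1}$. Then $\mathcal L_{X,J}\setminus\{\mathbf 0\}$ is a projective variety in $\mathbb P^n$, where $\mathbf 0=(0,\ldots,0)\in\mathbb C^{n+1}$; that is, there exist finitely many homogeneous polynomials $D_1,\ldots,D_r\in\mathbb Q[u_0,\ldots,u_n]$ such that $\mathcal L_{X,J}\setminus\{\mathbf 0\}$ is the set of nonzero common zeros of $D_1,\ldots,D_r$ in $\mathbb C^{n+1}$.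
   Context: Notation. $\mathcal V(\cdot)$ denotes a projective variety in $\mathbb P^n$ (complex projective space) and $\mathcal V_a(\cdot)$ an affine variety (common complex zeros). $\Delta_n=\{(p_0,\ldots,p_n)\in\mathbb R^{n+1}: p_i>0 \text{ for all } i,\ p_0+\cdots+p_n=1\}$. Algebraic statistical model: $X=\mathcal V(g_1,\ldots,g_s)\cap\Delta_n$, where $g_1,\ldots,g_s\in\mathbb Q[p_0,\ldots,p_n]$ are homogeneous and define an irreducible, generically reduced projective variety in $\mathbb P^n$. The $g_k$ (the model invariants) are fixed as part of the data of $X$. Lagrange likelihood equations: with parameters $\mathbf u=(u_0,\ldots,u_n)$ and unknowns $\mathbf p=(p_0,\ldots,p_n)$, $\Lambda=(\lambda_1,\ldots,\lambda_{s+1})$, $$F_i=p_i\Big(\lambda_1+\frac{\partial g_1}{\partial p_i}\lambda_2+\cdots+\frac{\partial g_s}{\partial p_i}\lambda_{s+1}\Big)-u_i\quad(0\le i\le n),$$ $$F_{n+k}=g_k(p_0,\ldots,p_n)\quad(1\le k\le s),\qquad F_{n+s+1}=p_0+\cdots+p_n-1.$$ Lagrange likelihood correspondence: $\mathcal L_X=\mathcal V_a(F_0,\ldots,F_{n+s+1})\subset\mathbb C^{n+1}\times\mathbb C^{n+1}\times\mathbb C^{s+1}$, with coordinates $(\mathbf u,\mathbf p,\Lambda)$. The map $\pi:(\mathbf u,\mathbf p,\Lambda)\mapsto\mathbf u$ is the canonical projection to $\mathbb C^{n+1}$. $J$ is the determinant of the $(n+s+2)\times(n+s+2)$ Jacobian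 matrix of $(F_0,\ldots,F_{n+s+1})$ with respect to $(p_0,\ldots,p_n,\lambda_1,\ldots,\lambda_{s+1})$. For $S\subset\mathbb C^{n+1}$, $\mathcal I(S)=\{D\in\mathbb Q[\mathbf u]: D(a)=0\ \forall a\in S\}$ and $\overline S=\mathcal V_a(\mathcal I(S))$. *)

theory Defs
  imports Complex_Main "HOL-Library.Poly_Mapping" "Jordan_Normal_Form.Determinant"
begin

section \<open>Multivariate polynomials\<close>

text \<open>Polynomials with variables in \<^typ>\<open>'v\<close> and coefficients in \<^typ>\<open>'a\<close> are finitely supported
  maps from monomials to coefficients; the ring operations are those of the library (convolution).\<close>

type_synonym ('v, 'a) mpol = "('v \<Rightarrow>\<^sub>0 nat) \<Rightarrow>\<^sub>0 'a"

definition Const :: "'a \<Rightarrow> ('v, 'a::zero) mpol" where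
  "Const = Poly_Mapping.single 0"

definition Var :: "'v \<Rightarrow> ('v, 'a::zero_neq_one) mpol" where
  "Var v = Poly_Mapping.single (Poly_Mapping.single v 1) 1"

text \<open>The value of \<open>f\<close> at \<open>x\<close> in a ring which need not be the coefficient ring: the coefficients
  are mapped by \<open>c\<close>, which is always a ring homomorphism below.\<close>

definition poly_eval :: "('a::zero \<Rightarrow> 'b::comm_ring_1) \<Rightarrow> ('v \<Rightarrow> 'b) \<Rightarrow> ('v, 'a) mpol \<Rightarrow> 'b" where
  "poly_eval c x f = (\<Sum>m\<in>Poly_Mapping.keys f. c (Poly_Mapping.lookup f m) *
                   (\<Prod>v\<in>Poly_Mapping.keys m. x v ^ Poly_Mapping.lookup m v))"

definition partial :: "'v \<Rightarrow> ('v, 'a::comm_ring_1) mpol \<Rightarrow> ('v, 'a) mpol" where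
  "partial v f = (\<Sum>m\<in>Poly_Mapping.keys f. Poly_Mapping.single (m - Poly_Mapping.single v 1)
                   (of_nat (Poly_Mapping.lookup m v) * Poly_Mapping.lookup f m))"

definition mon_degree :: "('v \<Rightarrow>\<^sub>0 nat) \<Rightarrow> nat" where
  "mon_degree m = (\<Sum>v\<in>Poly_Mapping.keys m. Poly_Mapping.lookup m v)"

text \<open>The zero polynomial is homogeneous of every degree.\<close>

definition homogeneous_of_degree :: "nat \<Rightarrow> ('v, 'a::zero) mpol \<Rightarrow> bool" where
  "homogeneous_of_degree d f \<longleftrightarrow> (\<forall>m\<in>Poly_Mapping.keys f. mon_degree m = d)"

definition homogeneous :: "('v, 'a::zero) mpol \<Rightarrow> bool" where
  "homogeneous f \<longleftrightarrow> (\<exists>d. homogeneous_of_degree d f)"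

text \<open>The polynomial ring in the $n+1$ variables with indices $0,\ldots,n$.\<close>

definition poly_ring :: "nat \<Rightarrow> (nat, 'a::zero) mpol set" where
  "poly_ring n = {f. \<forall>m\<in>Poly_Mapping.keys f. Poly_Mapping.keys m \<subseteq> {..n}}"

definition complexify :: "('v, rat) mpol \<Rightarrow> ('v, complex) mpol" where
  "complexify = Poly_Mapping.map of_rat"

section \<open>Projective varieties and statistical models\<close>

text \<open>A subset of $\mathbb P^n$ is represented by the set of all homogeneous coordinate vectors of
  its points, i.e. by its affine cone without the origin.\<close>

definition proj_variety :: "nat \<Rightarrow> (nat, complex) mpol set \<Rightarrow> complex vec set" where
  "proj_variety n S =
     {a \<in> carrier_vec (Suc n). a \<noteq> 0\<^sub>v (Suc n) \<and> (\<forall>f\<in>S. poly_eval id (\<lambda>i. a $ i) f = 0)}"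

text \<open>Irreducibility with respect to the Zariski topology of complex projective space.\<close>

definition proj_closed :: "nat \<Rightarrow> complex vec set \<Rightarrow> bool" where
  "proj_closed n V \<longleftrightarrow> (\<exists>S \<subseteq> poly_ring n. (\<forall>f\<in>S. homogeneous f) \<and> V = proj_variety n S)"

definition proj_irreducible :: "nat \<Rightarrow> complex vec set \<Rightarrow> bool" where
  "proj_irreducible n V \<longleftrightarrow> V \<noteq> {} \<and>
     (\<forall>A B. proj_closed n A \<and> proj_closed n B \<and> V = A \<union> B \<longrightarrow> V = A \<or> V = B)"

definition model_variety :: "nat \<Rightarrow> (nat, rat) mpol list \<Rightarrow> complex vec set" where
  "model_variety n gs = proj_variety n (complexify ` set gs)"

definition model_ideal :: "nat \<Rightarrow> (nat, rat) mpol list \<Rightarrow> (nat, complex) mpol set" where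
  "model_ideal n gs = {f. \<exists>a. (\<forall>k<length gs. a k \<in> poly_ring n) \<and>
                              f = (\<Sum>k<length gs. a k * complexify (gs ! k))}"

text \<open>Let $I$ be the ideal of $\mathbb C[p_0,\ldots,p_n]$ generated by the \<open>gs\<close>, and assume that
  $V = \mathcal V(I)$ is irreducible. The local ring of $\mathrm{Proj}(\mathbb C[p_0,\ldots,p_n]/I)$
  at the generic point of $V$ consists of the fractions $a/b$ with $a, b$ homogeneous of the same
  degree and $b$ not identically zero on $V$. Such a fraction is zero iff $h a \in I$ for some
  homogeneous $h$ not identically zero on $V$, whatever $b$ is, and its $m$-th power is $a^m/b^m$.
  Generic reducedness says that this local ring has no nonzero nilpotent elements.\<close>

definition generic_denominator :: "nat \<Rightarrow> (nat, rat) mpol list \<Rightarrow> (nat, complex) mpol \<Rightarrow> bool" where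
  "generic_denominator n gs h \<longleftrightarrow> h \<in> poly_ring n \<and> homogeneous h \<and>
     (\<exists>a\<in>model_variety n gs. poly_eval id (\<lambda>i. a $ i) h \<noteq> 0)"

definition generic_zero :: "nat \<Rightarrow> (nat, rat) mpol list \<Rightarrow> (nat, complex) mpol \<Rightarrow> bool" where
  "generic_zero n gs a \<longleftrightarrow> (\<exists>h. generic_denominator n gs h \<and> h * a \<in> model_ideal n gs)"

definition generically_reduced :: "nat \<Rightarrow> (nat, rat) mpol list \<Rightarrow> bool" where
  "generically_reduced n gs \<longleftrightarrow>
     (\<forall>d a b m. a \<in> poly_ring n \<and> homogeneous_of_degree d a \<and>
        generic_denominator n gs b \<and> homogeneous_of_degree d b \<and>
        generic_zero n gs (a ^ m) \<longrightarrow> generic_zero n gs a)"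

definition open_simplex :: "nat \<Rightarrow> real vec set" where
  "open_simplex n = {p \<in> carrier_vec (Suc n). (\<forall>i\<le>n. p $ i > 0) \<and> (\<Sum>i\<le>n. p $ i) = 1}"

text \<open>The model invariants \<open>gs\<close> are part of the data of the model \<open>X\<close>.\<close>

definition algebraic_statistical_model ::
    "nat \<Rightarrow> (nat, rat) mpol list \<Rightarrow> real vec set \<Rightarrow> bool" where
  "algebraic_statistical_model n gs X \<longleftrightarrow>
     (\<forall>g\<in>set gs. g \<in> poly_ring n \<and> homogeneous g) \<and>
     proj_irreducible n (model_variety n gs) \<and>
     generically_reduced n gs \<and>
     X = {p \<in> open_simplex n. map_vec complex_of_real p \<in> model_variety n gs}"

section \<open>Lagrange likelihood equations\<close>

text \<open>The variables $u_i$, $p_i$ and $\lambda_k$. All indices start at 0: with \<open>s = length gs\<close>,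
  the invariant $g_k$ is \<open>gs ! (k - 1)\<close> and the multiplier $\lambda_k$ is \<open>Lvar (k - 1)\<close>,
  for \<open>Lvar 0, \<dots>, Lvar s\<close>.\<close>

datatype lagrange_var = Uvar nat | Pvar nat | Lvar nat

definition in_p :: "(nat, rat) mpol \<Rightarrow> (lagrange_var, rat) mpol" where
  "in_p g = poly_eval Const (\<lambda>i. Var (Pvar i)) g"

definition lagrange_eq :: "nat \<Rightarrow> (nat, rat) mpol list \<Rightarrow> nat \<Rightarrow> (lagrange_var, rat) mpol" where
  "lagrange_eq n gs i =
     (if i \<le> n then
        Var (Pvar i) * (Var (Lvar 0) +
          (\<Sum>k<length gs. in_p (partial i (gs ! k)) * Var (Lvar (Suc k)))) - Var (Uvar i)
      else if i \<le> n + length gs then in_p (gs ! (i - Suc n))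
      else (\<Sum>j\<le>n. Var (Pvar j)) - 1)"

definition unknown :: "nat \<Rightarrow> nat \<Rightarrow> lagrange_var" where
  "unknown n j = (if j \<le> n then Pvar j else Lvar (j - Suc n))"

definition lagrange_jacobian :: "nat \<Rightarrow> (nat, rat) mpol list \<Rightarrow> (lagrange_var, rat) mpol mat" where
  "lagrange_jacobian n gs = mat (n + length gs + 2) (n + length gs + 2)
     (\<lambda>(i, j). partial (unknown n j) (lagrange_eq n gs i))"

definition jacobian_det :: "nat \<Rightarrow> (nat, rat) mpol list \<Rightarrow> (lagrange_var, rat) mpol" where
  "jacobian_det n gs = det (lagrange_jacobian n gs)"

type_synonym lagrange_point = "complex vec \<times> complex vec \<times> complex vec"

fun lagrange_coords :: "lagrange_point \<Rightarrow> lagrange_var \<Rightarrow> complex" where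
  "lagrange_coords (u, p, l) (Uvar i) = u $ i"
| "lagrange_coords (u, p, l) (Pvar i) = p $ i"
| "lagrange_coords (u, p, l) (Lvar k) = l $ k"

text \<open>Affine varieties in $\mathbb C^{n+1}\times\mathbb C^{n+1}\times\mathbb C^{s+1}$.\<close>

definition lagrange_affine_variety ::
    "nat \<Rightarrow> nat \<Rightarrow> (lagrange_var, rat) mpol set \<Rightarrow> lagrange_point set" where
  "lagrange_affine_variety n s S =
     {z \<in> carrier_vec (Suc n) \<times> carrier_vec (Suc n) \<times> carrier_vec (Suc s).
        \<forall>f\<in>S. poly_eval of_rat (lagrange_coords z) f = 0}"

definition lagrange_correspondence :: "nat \<Rightarrow> (nat, rat) mpol list \<Rightarrow> lagrange_point set" where
  "lagrange_correspondence n gs =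
     lagrange_affine_variety n (length gs) (lagrange_eq n gs ` {..n + length gs + 1})"

definition proj_u :: "lagrange_point \<Rightarrow> complex vec" where
  "proj_u = fst"

section \<open>The data discriminant locus\<close>

text \<open>Closed sets and closures in $\mathbb C^{n+1}$ with respect to polynomials with rational
  coefficients.\<close>

definition affine_variety :: "nat \<Rightarrow> (nat, rat) mpol set \<Rightarrow> complex vec set" where
  "affine_variety n S = {a \<in> carrier_vec (Suc n). \<forall>D\<in>S. poly_eval of_rat (\<lambda>i. a $ i) D = 0}"

definition vanishing_ideal :: "nat \<Rightarrow> complex vec set \<Rightarrow> (nat, rat) mpol set" where
  "vanishing_ideal n S = {D \<in> poly_ring n. \<forall>a\<in>S. poly_eval of_rat (\<lambda>i. a $ i) D = 0}"

definition rat_closure :: "nat \<Rightarrow> complex vec set \<Rightarrow> complex vec set" where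
  "rat_closure n S = affine_variety n (vanishing_ideal n S)"

definition jacobian_locus :: "nat \<Rightarrow> (nat, rat) mpol list \<Rightarrow> complex vec set" where
  "jacobian_locus n gs = rat_closure n (proj_u `
     (lagrange_correspondence n gs \<inter>
      lagrange_affine_variety n (length gs) {jacobian_det n gs}))"

end

theory Submission
  imports Defs
begin

text \<open>Give the variables \<open>u\<close> and \<open>\<lambda>\<close> weight 1 and the variables \<open>p\<close> weight 0. All Lagrange likelihood
  equations, and hence their Jacobian determinant, are weighted homogeneous, so
  \<open>(u, p, \<lambda>) \<mapsto> (t u, p, t \<lambda>)\<close> with \<open>t \<noteq> 0\<close> preserves the common zeros. The projected set
  is therefore a cone, and since $\mathbb C$ is infinite its vanishing ideal contains the
  homogeneous components of its elements. By the Hilbert basis theorem finitely many elements of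
  this ideal cut out its zero set; their homogeneous components do so as well.\<close>

section \<open>Evaluation\<close>

definition mon_eval :: "('v \<Rightarrow> 'b::comm_ring_1) \<Rightarrow> ('v \<Rightarrow>\<^sub>0 nat) \<Rightarrow> 'b" where
  "mon_eval x m = (\<Prod>v\<in>Poly_Mapping.keys m. x v ^ Poly_Mapping.lookup m v)"

text \<open>Natural exponents cannot cancel, so the general inclusion \<open>keys_add\<close>
  becomes an equality for monomials. Additivity of \<open>mon_eval\<close> and \<open>weight\<close>
  rests on this.\<close>

lemma keys_add_nat:
  fixes m k :: "'v \<Rightarrow>\<^sub>0 nat"
  shows "Poly_Mapping.keys (m + k) = Poly_Mapping.keys m \<union> Poly_Mapping.keys k"
  by (auto simp: in_keys_iff lookup_add)

lemma mon_eval_superset: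
  assumes "finite A" "Poly_Mapping.keys m \<subseteq> A"
  shows "mon_eval x m = (\<Prod>v\<in>A. x v ^ Poly_Mapping.lookup m v)"
  unfolding mon_eval_def
  by (rule prod.mono_neutral_left) (use assms in \<open>auto simp: in_keys_iff\<close>)

lemma mon_eval_add: "mon_eval x (m + k) = mon_eval x m * mon_eval x k"
proof -
  let ?A = "Poly_Mapping.keys m \<union> Poly_Mapping.keys k"
  have "mon_eval x (m + k) = (\<Prod>v\<in>?A. x v ^ Poly_Mapping.lookup (m + k) v)"
    by (simp add: mon_eval_def keys_add_nat)
  also have "\<dots> = (\<Prod>v\<in>?A. x v ^ Poly_Mapping.lookup m v) * (\<Prod>v\<in>?A. x v ^ Poly_Mapping.lookup k v)"
    by (simp add: lookup_add power_add prod.distrib)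
  also have "\<dots> = mon_eval x m * mon_eval x k"
    by (simp add: mon_eval_superset[of ?A m] mon_eval_superset[of ?A k])
  finally show ?thesis .
qed

lemma poly_eval_mon_eval:
  "poly_eval c x f = (\<Sum>m\<in>Poly_Mapping.keys f. c (Poly_Mapping.lookup f m) * mon_eval x m)"
  by (simp add: poly_eval_def mon_eval_def)

lemma sum_single_lookup:
  fixes f :: "'k \<Rightarrow>\<^sub>0 'a::comm_monoid_add"
  shows "(\<Sum>m\<in>Poly_Mapping.keys f. Poly_Mapping.single m (Poly_Mapping.lookup f m)) = f"
  by (rule poly_mapping_eqI)
    (simp add: lookup_sum lookup_single when_def sum.delta in_keys_iff)

lemma single_mult_eq_sum:
  fixes f :: "'k::monoid_add \<Rightarrow>\<^sub>0 'a::semiring_0"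
  shows "Poly_Mapping.single k a * f =
    (\<Sum>m\<in>Poly_Mapping.keys f. Poly_Mapping.single (k + m) (a * Poly_Mapping.lookup f m))"
  by (subst sum_single_lookup[of f, symmetric]) (simp add: sum_distrib_left mult_single)

locale additive_coeff_map =
  fixes c :: "'a::comm_ring_1 \<Rightarrow> 'b::comm_ring_1"
  assumes map_zero: "c 0 = 0" and map_add: "c (a + b) = c a + c b"
begin

lemma poly_eval_superset:
  assumes "finite A" "Poly_Mapping.keys f \<subseteq> A"
  shows "poly_eval c x f = (\<Sum>m\<in>A. c (Poly_Mapping.lookup f m) * mon_eval x m)"
  unfolding poly_eval_mon_eval
  by (rule sum.mono_neutral_left) (use assms map_zero in \<open>auto simp: in_keys_iff\<close>)

lemma poly_eval_zero: "poly_eval c x 0 = 0"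
  by (simp add: poly_eval_def)

lemma poly_eval_single: "poly_eval c x (Poly_Mapping.single m a) = c a * mon_eval x m"
  by (subst poly_eval_superset[of "{m}"]) auto

lemma poly_eval_add: "poly_eval c x (f + g) = poly_eval c x f + poly_eval c x g"
proof -
  let ?A = "Poly_Mapping.keys f \<union> Poly_Mapping.keys g"
  show ?thesis
    using keys_add[of f g]
    by (simp add: poly_eval_superset[of ?A] lookup_add map_add distrib_right sum.distrib)
qed

lemma poly_eval_sum: "poly_eval c x (sum f A) = (\<Sum>i\<in>A. poly_eval c x (f i))"
  by (induction A rule: infinite_finite_induct) (auto simp: poly_eval_zero poly_eval_add)

end

text \<open>Multiplying by one term shifts every monomial by \<open>k\<close>, and the common factor
  leaves the sum. Ideals appear below as sets closed under differences and multiplication by single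
  terms, so this is the product rule that they call for.\<close>

lemma poly_eval_single_mult:
  assumes "additive_coeff_map c" and mult: "\<And>a b. c (a * b) = c a * c b"
  shows "poly_eval c x (Poly_Mapping.single k a * f) = c a * mon_eval x k * poly_eval c x f"
proof -
  interpret additive_coeff_map c by fact
  show ?thesis
    by (simp add: single_mult_eq_sum poly_eval_sum poly_eval_single mult mon_eval_add poly_eval_mon_eval[of c x f]
        sum_distrib_left mult.assoc mult.left_commute)
qed

lemma additive_of_rat: "additive_coeff_map (of_rat :: rat \<Rightarrow> complex)"
  by unfold_locales (auto simp: of_rat_add)

interpretation of_rat: additive_coeff_map "of_rat :: rat \<Rightarrow> complex"
  by (rule additive_of_rat)

section \<open>Weighted homogeneity\<close>

definition weight :: "('v \<Rightarrow> nat) \<Rightarrow> ('v \<Rightarrow>\<^sub>0 nat) \<Rightarrow> nat" where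
  "weight w m = (\<Sum>v\<in>Poly_Mapping.keys m. Poly_Mapping.lookup m v * w v)"

text \<open>The degree is an integer so that subtracting the weight of a variable is not truncated.\<close>

definition w_homogeneous :: "('v \<Rightarrow> nat) \<Rightarrow> int \<Rightarrow> ('v, 'a::zero) mpol \<Rightarrow> bool" where
  "w_homogeneous w d f \<longleftrightarrow> (\<forall>m\<in>Poly_Mapping.keys f. int (weight w m) = d)"

lemma weight_superset:
  assumes "finite A" "Poly_Mapping.keys m \<subseteq> A"
  shows "weight w m = (\<Sum>v\<in>A. Poly_Mapping.lookup m v * w v)"
  unfolding weight_def
  by (rule sum.mono_neutral_left) (use assms in \<open>auto simp: in_keys_iff\<close>)

lemma weight_zero [simp]: "weight w 0 = 0"
  by (simp add: weight_def)

lemma weight_single [simp]: "weight w (Poly_Mapping.single v k) = k * w v"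
  by (subst weight_superset[of "{v}"]) auto

lemma weight_add: "weight w (m + k) = weight w m + weight w k"
proof -
  let ?A = "Poly_Mapping.keys m \<union> Poly_Mapping.keys k"
  show ?thesis
    by (simp add: weight_superset[of ?A] keys_add_nat lookup_add distrib_right sum.distrib)
qed

lemma w_homogeneous_zero [simp]: "w_homogeneous w d 0"
  by (simp add: w_homogeneous_def)

lemma w_homogeneous_single: "int (weight w m) = d \<Longrightarrow> w_homogeneous w d (Poly_Mapping.single m a)"
  by (simp add: w_homogeneous_def)

lemma w_homogeneous_one [simp]: "w_homogeneous w 0 (1 :: ('v, 'a::zero_neq_one) mpol)"
  by (simp add: w_homogeneous_def)

lemma w_homogeneous_Const [simp]: "w_homogeneous w 0 (Const a)"
  by (simp add: Const_def w_homogeneous_single)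

lemma w_homogeneous_Var: "int (w v) = d \<Longrightarrow> w_homogeneous w d (Var v)"
  by (simp add: Var_def w_homogeneous_single)

lemma w_homogeneous_add:
  "w_homogeneous w d f \<Longrightarrow> w_homogeneous w d g \<Longrightarrow> w_homogeneous w d (f + g)"
  using keys_add[of f g] unfolding w_homogeneous_def by blast

lemma w_homogeneous_uminus:
  fixes f :: "('v, 'a::ab_group_add) mpol"
  shows "w_homogeneous w d f \<Longrightarrow> w_homogeneous w d (- f)"
  by (simp add: w_homogeneous_def in_keys_iff)

lemma w_homogeneous_diff:
  fixes f :: "('v, 'a::ab_group_add) mpol"
  shows "w_homogeneous w d f \<Longrightarrow> w_homogeneous w d g \<Longrightarrow> w_homogeneous w d (f - g)"
  using w_homogeneous_add[OF _ w_homogeneous_uminus, of w d f g] by simp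

lemma w_homogeneous_sum:
  "(\<And>i. i \<in> A \<Longrightarrow> w_homogeneous w d (f i)) \<Longrightarrow> w_homogeneous w d (sum f A)"
  by (induction A rule: infinite_finite_induct) (auto intro: w_homogeneous_add)

lemma w_homogeneous_mult:
  fixes f g :: "('v, 'a::semiring_0) mpol"
  assumes "w_homogeneous w d f" "w_homogeneous w e g"
  shows "w_homogeneous w (d + e) (f * g)"
  using keys_mult[of f g] assms unfolding w_homogeneous_def
  by (fastforce simp: weight_add)

lemma w_homogeneous_prod:
  fixes f :: "'i \<Rightarrow> ('v, 'a::comm_ring_1) mpol"
  shows "(\<And>i. i \<in> A \<Longrightarrow> w_homogeneous w (d i) (f i)) \<Longrightarrow> w_homogeneous w (sum d A) (prod f A)"
  by (induction A rule: infinite_finite_induct) (simp_all add: w_homogeneous_mult)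

lemma w_homogeneous_power_zero:
  fixes f :: "('v, 'a::comm_ring_1) mpol"
  shows "w_homogeneous w 0 f \<Longrightarrow> w_homogeneous w 0 (f ^ k)"
  by (induction k) (use w_homogeneous_mult[of w 0 _ 0] in auto)

text \<open>Each surviving monomial loses one factor \<open>v\<close>; a monomial without
  \<open>v\<close> gets the coefficient 0. If the resulting degree is negative, the derivative is
  zero.\<close>

lemma w_homogeneous_partial:
  fixes f :: "('v, 'a::comm_ring_1) mpol"
  assumes "w_homogeneous w d f"
  shows "w_homogeneous w (d - int (w v)) (partial v f)"
  unfolding partial_def
proof (rule w_homogeneous_sum)
  fix m assume m: "m \<in> Poly_Mapping.keys f"
  show "w_homogeneous w (d - int (w v)) (Poly_Mapping.single (m - Poly_Mapping.single v 1)
          (of_nat (Poly_Mapping.lookup m v) * Poly_Mapping.lookup f m))"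
  proof (cases "Poly_Mapping.lookup m v = 0")
    case False
    \<comment> \<open>The exponent of \<open>v\<close> is at least 1, so the truncated subtraction
      is exact here.\<close>
    then have "m = (m - Poly_Mapping.single v 1) + Poly_Mapping.single v 1"
      by (intro poly_mapping_eqI) (auto simp: lookup_add lookup_minus lookup_single when_def)
    then have "weight w m = weight w (m - Poly_Mapping.single v 1) + w v"
      by (metis weight_add weight_single mult_1)
    then show ?thesis
      using assms m by (intro w_homogeneous_single) (auto simp: w_homogeneous_def)
  qed simp
qed

lemma mon_eval_scale:
  assumes "\<And>v. v \<in> Poly_Mapping.keys m \<Longrightarrow> y v = t ^ w v * x v"
  shows "mon_eval y m = t ^ weight w m * mon_eval x m"
proof -
  have "mon_eval y m = (\<Prod>v\<in>Poly_Mapping.keys m. t ^ (Poly_Mapping.lookup m v * w v) * x v ^ Poly_Mapping.lookup m v)"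
    unfolding mon_eval_def
    by (rule prod.cong) (auto simp: assms power_mult_distrib power_mult[symmetric] mult.commute)
  then show ?thesis
    by (simp add: prod.distrib mon_eval_def weight_def power_sum)
qed

text \<open>All monomials acquire the same factor, which can be pulled out. The relation between
  \<open>x\<close> and \<open>y\<close> is asked only for variables that occur in \<open>f\<close>,
  so that vector entries beyond the dimension do not matter.\<close>

lemma poly_eval_scale:
  fixes t :: "'b::field"
  assumes "w_homogeneous w d f" "t \<noteq> 0"
    and y: "\<And>m v. m \<in> Poly_Mapping.keys f \<Longrightarrow> v \<in> Poly_Mapping.keys m \<Longrightarrow> y v = t ^ w v * x v"
  shows "poly_eval c y f = t powi d * poly_eval c x f"
proof -
  have "mon_eval y m = t powi d * mon_eval x m" if "m \<in> Poly_Mapping.keys f" for m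
    using that assms(1) mon_eval_scale[of m y t w x] y[OF that]
    by (auto simp: w_homogeneous_def simp flip: power_int_of_nat)
  then show ?thesis
    by (simp add: poly_eval_mon_eval sum_distrib_left mult.left_commute)
qed

section \<open>Scaling the Lagrange likelihood correspondence\<close>

text \<open>Variables outside the range of the coordinate vectors get weight 0, because scalar
  multiplication leaves the junk values of a vector outside its dimension unchanged.\<close>

fun lagrange_weight :: "nat \<Rightarrow> nat \<Rightarrow> lagrange_var \<Rightarrow> nat" where
  "lagrange_weight n s (Uvar i) = (if i \<le> n then 1 else 0)"
| "lagrange_weight n s (Pvar i) = 0"
| "lagrange_weight n s (Lvar k) = (if k \<le> s then 1 else 0)"

lemma smult_vec_index_out: "\<not> i < dim_vec v \<Longrightarrow> (t \<cdot>\<^sub>v v) $ i = v $ i"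
  unfolding smult_vec_def by transfer (auto simp: mk_vec_def)

lemma lagrange_coords_scale:
  assumes "u \<in> carrier_vec (Suc n)" "l \<in> carrier_vec (Suc s)"
  shows "lagrange_coords (t \<cdot>\<^sub>v u, p, t \<cdot>\<^sub>v l) v = t ^ lagrange_weight n s v * lagrange_coords (u, p, l) v"
  using assms by (cases v) (auto simp: smult_vec_index_out)

text \<open>Only variables \<open>Pvar i\<close> occur, and these have weight 0.\<close>

lemma w_homogeneous_in_p: "w_homogeneous (lagrange_weight n s) 0 (in_p g)"
  unfolding in_p_def poly_eval_def
proof (rule w_homogeneous_sum)
  fix m
  have "w_homogeneous (lagrange_weight n s) (\<Sum>v\<in>Poly_Mapping.keys m. 0)
      (\<Prod>v\<in>Poly_Mapping.keys m. (Var (Pvar v) :: (lagrange_var, rat) mpol) ^ Poly_Mapping.lookup m v)"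
    by (intro w_homogeneous_prod w_homogeneous_power_zero w_homogeneous_Var) simp
  from w_homogeneous_mult[OF w_homogeneous_Const this]
  show "w_homogeneous (lagrange_weight n s) 0 (Const (Poly_Mapping.lookup g m) *
      (\<Prod>v\<in>Poly_Mapping.keys m. (Var (Pvar v) :: (lagrange_var, rat) mpol) ^ Poly_Mapping.lookup m v))"
    by simp
qed

definition lagrange_degree :: "nat \<Rightarrow> nat \<Rightarrow> int" where
  "lagrange_degree n i = (if i \<le> n then 1 else 0)"

text \<open>The first \<open>n + 1\<close> equations are linear in u and \<lambda> jointly. The
  remaining ones involve p alone, so even the normalization, which is inhomogeneous in the usual
  grading, has degree 0.\<close>

lemma w_homogeneous_lagrange_eq:
  "w_homogeneous (lagrange_weight n (length gs)) (lagrange_degree n i) (lagrange_eq n gs i)"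
proof -
  let ?w = "lagrange_weight n (length gs)"
  have V: "w_homogeneous ?w (int (?w v)) (Var v :: (lagrange_var, rat) mpol)" for v
    by (simp add: w_homogeneous_Var)
  \<comment> \<open>The bound on \<open>k\<close> puts the index \<open>Suc k\<close> within the
    range where \<open>Lvar\<close> has weight 1.\<close>
  have L: "w_homogeneous ?w 1 (in_p g * Var (Lvar (Suc k)))" if "k < length gs" for g k
    using w_homogeneous_mult[OF w_homogeneous_in_p[of n "length gs" g] V[of "Lvar (Suc k)"]] that by simp
  have S: "w_homogeneous ?w 1 (Var (Lvar 0) +
      (\<Sum>k<length gs. in_p (partial i (gs ! k)) * Var (Lvar (Suc k))))"
    using V[of "Lvar 0"] by (intro w_homogeneous_add w_homogeneous_sum L) auto
  show ?thesis
    using w_homogeneous_mult[OF V[of "Pvar i"] S] V[of "Uvar i"] V[of "Pvar _"] w_homogeneous_in_p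
    by (auto simp: lagrange_eq_def lagrange_degree_def
        intro!: w_homogeneous_diff w_homogeneous_sum)
qed

text \<open>The entry in row \<open>i\<close> and column \<open>j\<close> has degree \<open>r i - c j\<close>, hence all summands of the
  determinant have the same degree.\<close>

lemma w_homogeneous_jacobian_det:
  "\<exists>d. w_homogeneous (lagrange_weight n (length gs)) d (jacobian_det n gs)"
proof -
  let ?N = "n + length gs + 2" and ?w = "lagrange_weight n (length gs)"
  let ?r = "\<lambda>i. lagrange_degree n i" and ?c = "\<lambda>j. int (?w (unknown n j))"
  let ?d = "(\<Sum>i=0..<?N. ?r i) - (\<Sum>j=0..<?N. ?c j)"
  have det: "jacobian_det n gs = (\<Sum>q | q permutes {0..<?N}.
      signof q * (\<Prod>i = 0..<?N. lagrange_jacobian n gs $$ (i, q i)))"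
    unfolding jacobian_det_def by (rule det_def') (simp add: lagrange_jacobian_def)
  have "w_homogeneous ?w ?d (jacobian_det n gs)"
    unfolding det
  proof (rule w_homogeneous_sum, clarify)
    fix q assume q: "q permutes {0..<?N}"
    have "w_homogeneous ?w (\<Sum>i=0..<?N. ?r i - ?c (q i))
        (\<Prod>i = 0..<?N. lagrange_jacobian n gs $$ (i, q i))"
    proof (rule w_homogeneous_prod)
      fix i assume i: "i \<in> {0..<?N}"
      then have "q i \<in> {0..<?N}" using q by (simp only: permutes_in_image)
      with i show "w_homogeneous ?w (?r i - ?c (q i)) (lagrange_jacobian n gs $$ (i, q i))"
        by (simp add: lagrange_jacobian_def w_homogeneous_partial w_homogeneous_lagrange_eq)
    qed
    \<comment> \<open>Reindexing along \<open>q\<close> leaves the total column degree unchanged, so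
      the degree does not depend on \<open>q\<close>.\<close>
    moreover have "(\<Sum>i=0..<?N. ?r i - ?c (q i)) = ?d"
      using sum.permute[OF q, of ?c] by (simp only: sum_subtractf o_def)
    ultimately have "w_homogeneous ?w ?d (\<Prod>i = 0..<?N. lagrange_jacobian n gs $$ (i, q i))"
      by (simp only:)
    then show "w_homogeneous ?w ?d (signof q * (\<Prod>i = 0..<?N. lagrange_jacobian n gs $$ (i, q i)))"
      by (simp add: sign_def w_homogeneous_uminus)
  qed
  then show ?thesis by blast
qed

lemma critical_data_scale:
  fixes t :: complex
  assumes t: "t \<noteq> 0"
    and u: "u \<in> proj_u ` (lagrange_correspondence n gs \<inter>
      lagrange_affine_variety n (length gs) {jacobian_det n gs})" (is "_ \<in> proj_u ` ?L")
  shows "t \<cdot>\<^sub>v u \<in> proj_u ` ?L"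
proof -
  let ?w = "lagrange_weight n (length gs)"
  obtain p l where upl: "(u, p, l) \<in> ?L"
    using u by (auto simp: proj_u_def)
  have carrier: "u \<in> carrier_vec (Suc n)" "p \<in> carrier_vec (Suc n)" "l \<in> carrier_vec (Suc (length gs))"
    using upl by (auto simp: lagrange_affine_variety_def)
  have scale: "poly_eval of_rat (lagrange_coords (t \<cdot>\<^sub>v u, p, t \<cdot>\<^sub>v l)) f =
      t powi d * poly_eval of_rat (lagrange_coords (u, p, l)) f"
    if "w_homogeneous ?w d f" for d and f :: "(lagrange_var, rat) mpol"
    by (rule poly_eval_scale[OF that t]) (rule lagrange_coords_scale[OF carrier(1,3)])
  obtain d where "w_homogeneous ?w d (jacobian_det n gs)"
    using w_homogeneous_jacobian_det by blast
  from scale[OF this] scale[OF w_homogeneous_lagrange_eq] upl carrier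
  have "(t \<cdot>\<^sub>v u, p, t \<cdot>\<^sub>v l) \<in> ?L"
    by (auto simp: lagrange_correspondence_def lagrange_affine_variety_def)
  then show ?thesis by (force simp: proj_u_def)
qed

section \<open>Dickson's lemma and the Hilbert basis theorem\<close>

text \<open>Coordinates are treated one at a time: refine the subsequence so that the next
  coordinate increases. Earlier coordinates stay increasing on any further subsequence.\<close>

lemma nat_sequences_common_incseq:
  fixes f :: "nat \<Rightarrow> nat \<Rightarrow> nat"
  shows "\<exists>r. strict_mono r \<and> (\<forall>v<k. incseq (\<lambda>i. f (r i) v))"
proof (induction k)
  case 0
  then show ?case by (auto intro!: exI[of _ id] simp: strict_mono_def)
next
  case (Suc k)
  then obtain r where r: "strict_mono r" "\<And>v. v < k \<Longrightarrow> incseq (\<lambda>i. f (r i) v)" by blast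
  obtain q where q: "strict_mono q" "monoseq (\<lambda>i. f (r (q i)) k)"
    using seq_monosub[of "\<lambda>i. f (r i) k"] by (auto simp: o_def)
  obtain j where j: "incseq (\<lambda>i. f (r (q (i + j))) k)"
  proof (cases "incseq (\<lambda>i. f (r (q i)) k)")
    case True
    then show ?thesis using that[of 0] by simp
  next
    case False
    with q(2) have dec: "decseq (\<lambda>i. f (r (q i)) k)"
      by (simp add: monoseq_iff)
    \<comment> \<open>A decreasing sequence of naturals attains its minimum \<open>y\<close> and is
      constant from there on; dropping the first \<open>j\<close> terms makes it increasing.\<close>
    define y where "y = (LEAST y. \<exists>i. y = f (r (q i)) k)"
    have "\<exists>i. y = f (r (q i)) k" unfolding y_def by (rule LeastI_ex) blast
    then obtain j where j: "y = f (r (q j)) k" by blast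
    have "f (r (q (i + j))) k = y" for i
    proof (rule antisym)
      show "f (r (q (i + j))) k \<le> y" using dec j by (auto simp: decseq_def)
      show "y \<le> f (r (q (i + j))) k" unfolding y_def by (rule Least_le) blast
    qed
    then show ?thesis by (intro that[of j]) (simp add: incseq_def)
  qed
  let ?r = "\<lambda>i. r (q (i + j))"
  have "incseq (\<lambda>i. f (?r i) v)" if "v < Suc k" for v
  proof (cases "v = k")
    case False
    with that have "incseq (\<lambda>i. f (r i) v)" by (intro r) simp
    with q(1) show ?thesis by (auto simp: incseq_def strict_mono_less_eq)
  qed (use j in simp)
  moreover have "strict_mono ?r"
    using r(1) q(1) by (auto simp: strict_mono_def)
  ultimately show ?case by blast
qed

text \<open>The elements of \<open>M\<close> that are minimal for divisibility serve as
  \<open>B\<close>. If there were infinitely many, a common increasing subsequence of their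
  exponents would give two distinct comparable ones.\<close>

lemma dickson:
  fixes M :: "(nat \<Rightarrow>\<^sub>0 nat) set"
  assumes M: "\<And>m. m \<in> M \<Longrightarrow> Poly_Mapping.keys m \<subseteq> {..n}"
  shows "\<exists>B\<subseteq>M. finite B \<and> (\<forall>m\<in>M. \<exists>b\<in>B. \<exists>q. m = q + b)"
proof -
  \<comment> \<open>This is divisibility of monomials; the library order on
    \<open>\<Rightarrow>\<^sub>0\<close> is the lexicographic one.\<close>
  define le where "le a b \<longleftrightarrow> (\<forall>v. Poly_Mapping.lookup a v \<le> Poly_Mapping.lookup b v)"
    for a b :: "nat \<Rightarrow>\<^sub>0 nat"
  have le_refl: "le a a" for a by (simp add: le_def)
  have le_trans: "le a d" if "le a b" "le b d" for a b d
    using that unfolding le_def by (blast intro: order_trans)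
  define B where "B = {b\<in>M. \<forall>a\<in>M. le a b \<longrightarrow> a = b}"
  have "finite B"
  proof (rule ccontr)
    assume "infinite B"
    then obtain f :: "nat \<Rightarrow> nat \<Rightarrow>\<^sub>0 nat" where f: "inj f" "range f \<subseteq> B"
      using infinite_countable_subset by blast
    obtain r where r: "strict_mono r" "\<And>v. v < Suc n \<Longrightarrow> incseq (\<lambda>i. Poly_Mapping.lookup (f (r i)) v)"
      using nat_sequences_common_incseq[of "Suc n" "\<lambda>i. Poly_Mapping.lookup (f i)"] by blast
    have fB: "f i \<in> B" for i using f(2) by blast
    have "le (f (r 0)) (f (r 1))" unfolding le_def
    proof
      fix v
      show "Poly_Mapping.lookup (f (r 0)) v \<le> Poly_Mapping.lookup (f (r 1)) v"
      proof (cases "v \<le> n")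
        case True
        then show ?thesis using r(2)[of v] by (auto simp: incseq_def)
      next
        case False
        then have "v \<notin> Poly_Mapping.keys (f (r 0))" using M fB[of "r 0"] by (auto simp: B_def)
        then show ?thesis by (simp add: in_keys_iff)
      qed
    qed
    then have "f (r 0) = f (r 1)" using fB[of "r 0"] fB[of "r 1"] by (auto simp: B_def)
    then have "r 0 = r 1" using f(1) by (auto dest: injD)
    with r(1) show False by (auto simp: strict_mono_eq)
  qed
  moreover have "\<exists>b\<in>B. \<exists>q. m = q + b" if m: "m \<in> M" for m
  proof -
    \<comment> \<open>A divisor of \<open>m\<close> in \<open>M\<close> of least total degree is
      minimal: all variables of \<open>M\<close> have index at most \<open>n\<close>, so a proper
      divisor has strictly smaller \<open>?size\<close>.\<close>
    let ?size = "\<lambda>a. \<Sum>v\<le>n. Poly_Mapping.lookup a v"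
    obtain b where b: "b \<in> M" "le b m" and
      least: "\<And>a. a \<in> M \<Longrightarrow> le a m \<Longrightarrow> ?size b \<le> ?size a"
      using ex_has_least_nat[of "\<lambda>a. a \<in> M \<and> le a m" m ?size] m le_refl by blast
    have "a = b" if a: "a \<in> M" "le a b" for a
    proof (rule ccontr)
      assume "a \<noteq> b"
      then obtain v where v: "Poly_Mapping.lookup a v \<noteq> Poly_Mapping.lookup b v"
        using poly_mapping_eqI[of a b] by metis
      with a have lt: "Poly_Mapping.lookup a v < Poly_Mapping.lookup b v"
        by (simp add: le_def order_less_le)
      then have "v \<in> Poly_Mapping.keys b" by (simp add: in_keys_iff)
      then have "v \<le> n" using M[OF b(1)] by auto
      with lt a have "?size a < ?size b"
        by (intro sum_strict_mono_ex1) (auto simp: le_def)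
      moreover have "le a m" using a(2) b(2) by (rule le_trans)
      ultimately show False using least[OF a(1)] by simp
    qed
    with b have "b \<in> B" by (auto simp: B_def)
    \<comment> \<open>Divisibility makes the truncated subtraction of exponents exact.\<close>
    moreover have "m = (m - b) + b"
      using b by (intro poly_mapping_eqI) (auto simp: le_def lookup_add lookup_minus)
    ultimately show ?thesis by blast
  qed
  ultimately show ?thesis by (intro exI[of _ B]) (auto simp: B_def)
qed

section \<open>Lexicographic order and leading monomials\<close>

lemma lex_zero_least: "(0 :: nat \<Rightarrow>\<^sub>0 nat) \<le> m"
proof -
  have "\<not> m < 0" by transfer (auto simp: less_fun_def)
  then show ?thesis by simp
qed

text \<open>Well-ordering of monomials in finitely many variables: every multiple
  \<open>q + b\<close> is at least \<open>b\<close>, so the least of the finitely many Dickson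
  generators is least in \<open>M\<close>. With unboundedly many variables, the chain x_0 > x_1 >
  ... would have no least element.\<close>

lemma lex_least_monomial:
  fixes M :: "(nat \<Rightarrow>\<^sub>0 nat) set"
  assumes "\<And>m. m \<in> M \<Longrightarrow> Poly_Mapping.keys m \<subseteq> {..n}" and "M \<noteq> {}"
  obtains a where "a \<in> M" "\<And>m. m \<in> M \<Longrightarrow> a \<le> m"
proof -
  have "\<exists>B\<subseteq>M. finite B \<and> (\<forall>m\<in>M. \<exists>b\<in>B. \<exists>q. m = q + b)"
    by (rule dickson) (rule assms(1))
  then obtain B where B: "B \<subseteq> M" "finite B" "\<forall>m\<in>M. \<exists>b\<in>B. \<exists>q. m = q + b"
    by (elim exE conjE)
  have ne: "B \<noteq> {}" using B(3) assms(2) by blast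
  show ?thesis
  proof (rule that[of "Min B"])
    show "Min B \<in> M" using B ne Min_in by blast
    fix m assume "m \<in> M"
    then obtain b q where b: "b \<in> B" "m = q + b" using B(3) by meson
    have "Min B \<le> b" using B b by simp
    also have "b \<le> m" using add_right_mono[OF lex_zero_least[of q], of b] b by simp
    finally show "Min B \<le> m" .
  qed
qed

text \<open>The leading monomial in the lexicographic order. For the zero polynomial it is the
  unspecified \<open>Max {}\<close>, hence the care below to exclude 0.\<close>

abbreviation lead :: "(nat, 'a::zero) mpol \<Rightarrow> (nat \<Rightarrow>\<^sub>0 nat)" where
  "lead f \<equiv> Max (Poly_Mapping.keys f)"

lemma lead_in_keys: "f \<noteq> 0 \<Longrightarrow> lead f \<in> Poly_Mapping.keys (f :: (nat, 'a::comm_ring_1) mpol)"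
  by (intro Max_in) (auto simp: poly_mapping_eq_iff fun_eq_iff in_keys_iff)

text \<open>Adding \<open>q\<close> to monomials is injective, so just one term contributes to this
  coefficient.\<close>

lemma lookup_single_mult_add:
  fixes g :: "(nat, 'a::comm_ring_1) mpol"
  shows "Poly_Mapping.lookup (Poly_Mapping.single q c * g) (q + m) = c * Poly_Mapping.lookup g m"
  by (simp add: single_mult_eq_sum lookup_sum lookup_single when_def sum.delta in_keys_iff)

text \<open>Both polynomials have all their monomials bounded by \<open>lead f\<close>, and their
  coefficients there agree, so that term cancels.\<close>

lemma lead_reduce:
  fixes f g :: "(nat, 'a::comm_ring_1) mpol"
  assumes lead: "lead f = q + lead g"
    and c: "c * Poly_Mapping.lookup g (lead g) = Poly_Mapping.lookup f (lead f)"
    and ne: "f - Poly_Mapping.single q c * g \<noteq> 0"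
  shows "lead (f - Poly_Mapping.single q c * g) < lead f"
proof -
  let ?h = "f - Poly_Mapping.single q c * g"
  have "lead ?h \<in> Poly_Mapping.keys f \<union> Poly_Mapping.keys (Poly_Mapping.single q c * g)"
    using lead_in_keys[OF ne] by (auto simp: in_keys_iff lookup_minus)
  moreover have "m \<le> lead f" if "m \<in> Poly_Mapping.keys (Poly_Mapping.single q c * g)" for m
  proof -
    obtain k where "k \<in> Poly_Mapping.keys g" "m = q + k"
      using keys_mult[of "Poly_Mapping.single q c" g] \<open>m \<in> _\<close> by (auto split: if_splits)
    then show ?thesis using lead by (simp add: add_left_mono)
  qed
  ultimately have "lead ?h \<le> lead f" by auto
  moreover have "Poly_Mapping.lookup ?h (lead f) = 0"
    using lookup_single_mult_add[of q c g "lead g"] c lead by (simp add: lookup_minus)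
  then have "lead f \<notin> Poly_Mapping.keys ?h" by (simp add: in_keys_iff)
  then have "lead ?h \<noteq> lead f" using lead_in_keys[OF ne] by metis
  ultimately show ?thesis by simp
qed

lemma poly_ring_diff:
  fixes f g :: "(nat, 'a::ab_group_add) mpol"
  shows "f \<in> poly_ring n \<Longrightarrow> g \<in> poly_ring n \<Longrightarrow> f - g \<in> poly_ring n"
proof -
  have "Poly_Mapping.keys (f - g) \<subseteq> Poly_Mapping.keys f \<union> Poly_Mapping.keys g"
    by (auto simp: in_keys_iff lookup_minus)
  then show "f \<in> poly_ring n \<Longrightarrow> g \<in> poly_ring n \<Longrightarrow> f - g \<in> poly_ring n"
    unfolding poly_ring_def by blast
qed

lemma poly_ring_single_mult:
  fixes g :: "(nat, 'a::comm_ring_1) mpol"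
  assumes "Poly_Mapping.keys q \<subseteq> {..n}" "g \<in> poly_ring n"
  shows "Poly_Mapping.single q c * g \<in> poly_ring n"
proof -
  have "Poly_Mapping.keys m \<subseteq> {..n}" if "m \<in> Poly_Mapping.keys (Poly_Mapping.single q c * g)" for m
    using that keys_mult[of "Poly_Mapping.single q c" g] assms
    by (fastforce simp: poly_ring_def keys_add_nat split: if_splits)
  then show ?thesis by (simp add: poly_ring_def)
qed

text \<open>If the leading monomials of \<open>G\<close> divide all leading monomials of \<open>I\<close>, then reduction by \<open>G\<close>
  lowers the leading monomial of an element of \<open>I\<close>, and this cannot go on for ever.\<close>

lemma hilbert_basis:
  fixes I :: "(nat, 'a::field) mpol set"
  assumes I: "I \<subseteq> poly_ring n"
    and diff: "\<And>f g. f \<in> I \<Longrightarrow> g \<in> I \<Longrightarrow> f - g \<in> I"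
    and mult: "\<And>g q c. g \<in> I \<Longrightarrow> Poly_Mapping.keys q \<subseteq> {..n} \<Longrightarrow> Poly_Mapping.single q c * g \<in> I"
    and c: "additive_coeff_map c" "\<And>a b. c (a * b) = c a * c b"
  obtains G where "finite G" "G \<subseteq> I"
    "\<And>f x. f \<in> I \<Longrightarrow> (\<And>g. g \<in> G \<Longrightarrow> poly_eval c x g = 0) \<Longrightarrow> poly_eval c x f = 0"
proof -
  interpret additive_coeff_map c by fact
  let ?M = "lead ` (I - {0})"
  have M: "Poly_Mapping.keys m \<subseteq> {..n}" if m: "m \<in> ?M" for m
  proof -
    obtain f where f: "f \<in> I" "f \<noteq> 0" "m = lead f" using m by blast
    then show ?thesis using I lead_in_keys[OF f(2)] unfolding poly_ring_def by blast
  qed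
  have "\<exists>B\<subseteq>?M. finite B \<and> (\<forall>m\<in>?M. \<exists>b\<in>B. \<exists>q. m = q + b)"
    by (rule dickson) (rule M)
  then obtain B where B: "B \<subseteq> ?M" "finite B" "\<forall>m\<in>?M. \<exists>b\<in>B. \<exists>q. m = q + b"
    by (elim exE conjE)
  obtain G where G: "G \<subseteq> I - {0}" "finite G" "B = lead ` G"
    using finite_subset_image[OF B(2,1)] by blast
  show ?thesis
  proof (rule that[of G])
    fix f x assume f: "f \<in> I" and x: "\<And>g. g \<in> G \<Longrightarrow> poly_eval c x g = 0"
    \<comment> \<open>Division is carried out at the fixed point \<open>x\<close>, without recording
      cofactors: a counterexample with least leading monomial is reduced to a smaller one.\<close>
    let ?bad = "{h\<in>I. poly_eval c x h \<noteq> 0}"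
    have nz: "h \<noteq> 0" if "h \<in> ?bad" for h using that poly_eval_zero by auto
    show "poly_eval c x f = 0"
    proof (rule ccontr)
      assume "poly_eval c x f \<noteq> 0"
      with f have ne: "lead ` ?bad \<noteq> {}" by blast
      have "lead ` ?bad \<subseteq> ?M" using nz by blast
      then obtain a where a: "a \<in> lead ` ?bad" "\<And>m. m \<in> lead ` ?bad \<Longrightarrow> a \<le> m"
        using lex_least_monomial[of "lead ` ?bad" n] ne M by (metis (no_types, lifting) subsetD)
      then obtain h where h: "h \<in> ?bad" "a = lead h" by blast
      have aM: "lead h \<in> ?M" using h nz by blast
      then obtain g q where g: "g \<in> G" and q: "lead h = q + lead g"
        using B(3) G(3) by blast
      have gI: "g \<in> I" "g \<noteq> 0" using g G by auto
      \<comment> \<open>The quotient of the leading coefficients, chosen to cancel the leading term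
        of \<open>h\<close>.\<close>
      let ?c = "Poly_Mapping.lookup h (lead h) / Poly_Mapping.lookup g (lead g)"
      let ?h = "h - Poly_Mapping.single q ?c * g"
      have "Poly_Mapping.keys q \<subseteq> {..n}" using M[OF aM] q by (auto simp: keys_add_nat)
      then have hI: "?h \<in> I" using h gI by (intro diff mult) auto
      \<comment> \<open>Since \<open>g\<close> vanishes at \<open>x\<close>, the reduction does not
        change the value there, and \<open>?h\<close> is again a counterexample.\<close>
      have "poly_eval c x (?h + Poly_Mapping.single q ?c * g) = poly_eval c x ?h"
        using x[OF g] by (simp only: poly_eval_add poly_eval_single_mult[OF c]) simp
      then have bad: "?h \<in> ?bad" using h hI by simp
      have "Poly_Mapping.lookup g (lead g) \<noteq> 0"
        using lead_in_keys[OF gI(2)] by (simp add: in_keys_iff)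
      then have "lead ?h < lead h"
        using q gI nz[OF bad] by (intro lead_reduce) auto
      moreover have "lead h \<le> lead ?h" using a(2) bad h(2) by blast
      ultimately show False by simp
    qed
  qed (use G in auto)
qed

section \<open>Homogeneous components\<close>

definition hcomp :: "nat \<Rightarrow> ('v, 'a::comm_monoid_add) mpol \<Rightarrow> ('v, 'a) mpol" where
  "hcomp d f = (\<Sum>m\<in>{m\<in>Poly_Mapping.keys f. mon_degree m = d}.
     Poly_Mapping.single m (Poly_Mapping.lookup f m))"

lemma keys_hcomp: "Poly_Mapping.keys (hcomp d f) \<subseteq> {m\<in>Poly_Mapping.keys f. mon_degree m = d}"
proof -
  have "Poly_Mapping.lookup (hcomp d f) m = (if mon_degree m = d then Poly_Mapping.lookup f m else 0)"
    for m
    by (simp add: hcomp_def lookup_sum lookup_single when_def sum.delta in_keys_iff)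
  then show ?thesis by (auto simp: in_keys_iff split: if_splits)
qed

lemma sum_hcomp:
  assumes "\<And>m. m \<in> Poly_Mapping.keys f \<Longrightarrow> mon_degree m \<le> N"
  shows "(\<Sum>d\<le>N. hcomp d f) = f"
  unfolding hcomp_def
  by (subst sum.group) (use assms in \<open>auto simp: sum_single_lookup\<close>)

lemma homogeneous_hcomp: "homogeneous_of_degree d (hcomp d f)"
  using keys_hcomp by (fastforce simp: homogeneous_of_degree_def)

lemma hcomp_poly_ring: "f \<in> poly_ring n \<Longrightarrow> hcomp d f \<in> poly_ring n"
  using keys_hcomp by (fastforce simp: poly_ring_def)

text \<open>Along the line through \<open>a\<close>, the value of \<open>f\<close> at t a is a
  polynomial in t whose coefficients are the values of the homogeneous components at
  \<open>a\<close>. It has infinitely many roots, so all its coefficients vanish.\<close>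

lemma hcomp_vanish:
  fixes f :: "(nat, rat) mpol" and a :: "complex vec"
  assumes f: "f \<in> poly_ring n" and a: "a \<in> carrier_vec (Suc n)"
    and zero: "\<And>t. t \<noteq> 0 \<Longrightarrow> poly_eval of_rat (\<lambda>i. (t \<cdot>\<^sub>v a) $ i) f = 0"
  shows "poly_eval of_rat (\<lambda>i. a $ i) (hcomp d f) = 0"
proof -
  \<comment> \<open>Inserting \<open>d\<close> ensures that the coefficient \<open>e d\<close> is
    among those considered, and that \<open>Max\<close> is taken over a nonempty set.\<close>
  define N where "N = Max (insert d (mon_degree ` Poly_Mapping.keys f))"
  define e where "e k = poly_eval of_rat (\<lambda>i. a $ i) (hcomp k f)" for k
  have N: "mon_degree m \<le> N" if "m \<in> Poly_Mapping.keys f" for m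
    using that by (auto simp: N_def)
  have dN: "d \<le> N" by (auto simp: N_def)
  have roots: "(\<Sum>k\<le>N. e k * t ^ k) = 0" if t: "t \<noteq> 0" for t
  proof -
    have e: "poly_eval of_rat (\<lambda>i. (t \<cdot>\<^sub>v a) $ i) (hcomp k f) = t powi int k * e k" for k
      unfolding e_def
    proof (rule poly_eval_scale[OF _ t])
      show "w_homogeneous (\<lambda>_. 1) (int k) (hcomp k f)"
        using homogeneous_hcomp[of k f]
        by (simp add: w_homogeneous_def homogeneous_of_degree_def weight_def mon_degree_def)
      fix m v assume "m \<in> Poly_Mapping.keys (hcomp k f)" "v \<in> Poly_Mapping.keys m"
      \<comment> \<open>Scaling multiplies only the entries within the dimension of
        \<open>a\<close>.\<close>
      then have "v \<le> n" using hcomp_poly_ring[OF f, of k] by (auto simp: poly_ring_def)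
      then show "(t \<cdot>\<^sub>v a) $ v = t ^ 1 * a $ v" using a by simp
    qed
    have "(\<Sum>k\<le>N. e k * t ^ k) = poly_eval of_rat (\<lambda>i. (t \<cdot>\<^sub>v a) $ i) (\<Sum>k\<le>N. hcomp k f)"
      by (simp add: of_rat.poly_eval_sum e mult.commute)
    then show ?thesis using zero[OF t] sum_hcomp[of f N] N by simp
  qed
  have "infinite (- {0::complex})"
    by (simp add: Compl_eq_Diff_UNIV infinite_UNIV_char_0)
  moreover have "- {0} \<subseteq> {t. (\<Sum>k\<le>N. e k * t ^ k) = 0}"
    using roots by auto
  ultimately have "infinite {t. (\<Sum>k\<le>N. e k * t ^ k) = 0}"
    using finite_subset by blast
  then have "e d = 0" using polyfun_roots_finite[of e d N] dN by blast
  then show ?thesis by (simp add: e_def)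
qed

section \<open>Homogeneous equations for the closed cone\<close>

theorem proposition2:
  fixes n :: nat and gs :: "(nat, rat) mpol list" and X :: "real vec set"
  assumes "algebraic_statistical_model n gs X"
  shows "\<exists>Ds :: (nat, rat) mpol set. finite Ds \<and>
           (\<forall>D\<in>Ds. D \<in> poly_ring n \<and> homogeneous D) \<and>
           jacobian_locus n gs - {0\<^sub>v (Suc n)} =
             {a \<in> carrier_vec (Suc n). a \<noteq> 0\<^sub>v (Suc n) \<and>
                (\<forall>D\<in>Ds. poly_eval of_rat (\<lambda>i. a $ i) D = 0)}"
proof -
  define S where "S = proj_u ` (lagrange_correspondence n gs \<inter>
      lagrange_affine_variety n (length gs) {jacobian_det n gs})"
  define I where "I = vanishing_ideal n S"
  have S_carrier: "S \<subseteq> carrier_vec (Suc n)"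
    by (auto simp: S_def proj_u_def lagrange_affine_variety_def)
  have I: "I \<subseteq> poly_ring n" by (auto simp: I_def vanishing_ideal_def)
  have mult: "Poly_Mapping.single q c * g \<in> I" if "g \<in> I" "Poly_Mapping.keys q \<subseteq> {..n}" for g q c
    using that by (simp add: I_def vanishing_ideal_def poly_ring_single_mult
        poly_eval_single_mult[OF additive_of_rat of_rat_mult])
  have diff: "f - g \<in> I" if "f \<in> I" "g \<in> I" for f g
  proof -
    have "poly_eval of_rat x (f - g) = (poly_eval of_rat x f - poly_eval of_rat x g :: complex)" for x
      using of_rat.poly_eval_add[of x "f - g" g] by simp
    then show ?thesis using that by (simp add: I_def vanishing_ideal_def poly_ring_diff)
  qed
  have hcomp: "hcomp d f \<in> I" if f: "f \<in> I" for d f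
  proof -
    have "poly_eval of_rat (\<lambda>i. a $ i) (hcomp d f) = 0" if a: "a \<in> S" for a
    proof (rule hcomp_vanish)
      fix t :: complex assume "t \<noteq> 0"
      then have "t \<cdot>\<^sub>v a \<in> S" using a critical_data_scale by (simp add: S_def)
      then show "poly_eval of_rat (\<lambda>i. (t \<cdot>\<^sub>v a) $ i) f = 0"
        using f by (simp add: I_def vanishing_ideal_def)
    qed (use f I a S_carrier in auto)
    then show ?thesis using f hcomp_poly_ring by (auto simp: I_def vanishing_ideal_def)
  qed
  obtain G where G: "finite G" "G \<subseteq> I" and
    basis: "\<And>f (x :: nat \<Rightarrow> complex). f \<in> I \<Longrightarrow>
      (\<And>g. g \<in> G \<Longrightarrow> poly_eval of_rat x g = 0) \<Longrightarrow> poly_eval of_rat x f = 0"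
    using hilbert_basis[OF I diff mult additive_of_rat of_rat_mult] by blast
  \<comment> \<open>One degree bound for all generators; inserting 0 keeps \<open>Max\<close>
    meaningful if there are no monomials.\<close>
  define N where "N = Max (insert 0 (\<Union>g\<in>G. mon_degree ` Poly_Mapping.keys g))"
  have N: "(\<Sum>d\<le>N. hcomp d g) = g" if "g \<in> G" for g
  proof (rule sum_hcomp)
    fix m assume "m \<in> Poly_Mapping.keys g"
    with that G show "mon_degree m \<le> N" unfolding N_def by (intro Max_ge) auto
  qed
  \<comment> \<open>The components lie in \<open>I\<close> because the projected set is a cone, and
    they add up to the generators, so \<open>Ds\<close> and \<open>I\<close> have the same
    zeros.\<close>
  define Ds where "Ds = (\<Union>g\<in>G. (\<lambda>d. hcomp d g) ` {..N})"
  have DsI: "Ds \<subseteq> I" using G hcomp by (auto simp: Ds_def)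
  have "poly_eval of_rat x f = 0" if "f \<in> I" "\<forall>D\<in>Ds. poly_eval of_rat x D = 0"
    for f and x :: "nat \<Rightarrow> complex"
  proof (rule basis[OF that(1)])
    fix g assume g: "g \<in> G"
    have "poly_eval of_rat x (\<Sum>d\<le>N. hcomp d g) = 0"
      unfolding of_rat.poly_eval_sum using that(2) g by (intro sum.neutral) (auto simp: Ds_def)
    then show "poly_eval of_rat x g = 0" using N[OF g] by simp
  qed
  then have "jacobian_locus n gs = affine_variety n Ds"
    using DsI by (auto simp: jacobian_locus_def rat_closure_def affine_variety_def
        S_def[symmetric] I_def[symmetric])
  moreover have "finite Ds" using G by (simp add: Ds_def)
  moreover have "\<forall>D\<in>Ds. D \<in> poly_ring n \<and> homogeneous D"
    using DsI I homogeneous_hcomp unfolding homogeneous_def Ds_def by blast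
  ultimately show ?thesis
    by (intro exI[of _ Ds]) (auto simp: affine_variety_def)
qed

end
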